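(* Let $G=\mathrm{GIRG}(n,\beta,w_0,d)$ be a standard GIRG with any $L_p$-norm, $p\in[1,\infty]$. Let $U_k=\{v_1,\dots,v_k\}$ be a set of $k$ vertices chosen uniformly at random, where $v_1$ has the minimal weight $w_1$ among them, and let $w_0\le w_+\le\sqrt{n/\lambda}$. Then $$\Pr\big[(U_k\text{ is a clique})\cap(w_0\le w_1\le w_+)\big]\ge 2^{-d(k-1)}\,\mathcal{C}\Big(\frac{\lambda}{n}\Big)^{k-1}\Big(w_+^{k(3-\beta)-2}-w_0^{k(3-\beta)-2}\Big),\qquad \mathcal{C}=\frac{(\beta-1)k\,w_0^{-(1-\beta)k}}{(3-\beta)k-2}.$$
   Context: Fix constants $\lambda>0$, $w_0>0$, $\beta>2$. A standard GIRG $\mathrm{GIRG}(n,\beta,w_0,d)$ with $L_p$-norm has $n$ vertices; each vertex $v$ independently receives a weight $w_v$ with $\Pr[w_v\le x]=1-(x/w_0)^{1-\beta}$ for $x\ge w_0$, and independently a position $\mathbf{x}_v$ uniform on the torus $\mathbb{T}^d=[0,1)^d$. Distances are $\|\mathbf{x}_u-\mathbf{x}_v\|_p$ computed from the coordinatewise circle distances $|x_{ui}-x_{vi}|_C=\min\{|x_{ui}-x_{vi}|,1-|x_{ui}-x_{vi}|\}$. Distinct $u,v$ are adjacent iff their distance is at most a threshold $t_{uv}$ chosen such that $\Pr[u\sim v\mid w_u,w_v]=\min\{1,\lambda w_uw_v/n\}$ (for $p=\infty$, $t_{uv}=\frac12(\lambda w_uw_v/n)^{1/d}$). A clique is a set of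 pairwise adjacent vertices. *)

theory Defs
  imports "HOL-Probability.Probability"
begin

definition weight_cdf :: "real \<Rightarrow> real \<Rightarrow> real \<Rightarrow> real" where
  "weight_cdf \<beta> w0 x = (if w0 \<le> x then 1 - (x / w0) powr (1 - \<beta>) else 0)"

definition weight_measure :: "real \<Rightarrow> real \<Rightarrow> real measure" where
  "weight_measure \<beta> w0 = interval_measure (weight_cdf \<beta> w0)"

lemma
  assumes "0 < w0" "1 < \<beta>"
  shows real_distribution_weight_measure: "real_distribution (weight_measure \<beta> w0)"
    and cdf_weight_measure: "cdf (weight_measure \<beta> w0) = weight_cdf \<beta> w0"
proof -
  have mono: "weight_cdf \<beta> w0 x \<le> weight_cdf \<beta> w0 y" if "x \<le> y" for x y
  proof (cases "w0 \<le> x")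
    case True
    then have "(y / w0) powr (1 - \<beta>) \<le> (x / w0) powr (1 - \<beta>)"
      using assms that by (intro powr_mono2') (auto simp: divide_right_mono)
    then show ?thesis using True that by (simp add: weight_cdf_def)
  next
    case False
    have "(y / w0) powr (1 - \<beta>) \<le> 1" if "w0 \<le> y"
      using powr_mono2'[of "1 - \<beta>" 1 "y / w0"] assms that by simp
    then show ?thesis using False by (simp add: weight_cdf_def)
  qed
  have rc: "continuous (at_right a) (weight_cdf \<beta> w0)" for a
  proof (cases "w0 \<le> a")
    case True
    have "((\<lambda>x. 1 - (x / w0) powr (1 - \<beta>)) \<longlongrightarrow> 1 - (a / w0) powr (1 - \<beta>)) (at_right a)"
      using True assms by (intro tendsto_diff tendsto_const tendsto_powr tendsto_divide tendsto_ident_at) auto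
    moreover have "\<forall>\<^sub>F x in at_right a. 1 - (x / w0) powr (1 - \<beta>) = weight_cdf \<beta> w0 x"
      using True by (auto simp: eventually_at_filter weight_cdf_def intro!: always_eventually)
    ultimately have "(weight_cdf \<beta> w0 \<longlongrightarrow> 1 - (a / w0) powr (1 - \<beta>)) (at_right a)"
      by (rule Lim_transform_eventually)
    then show ?thesis using True by (simp add: continuous_within weight_cdf_def)
  next
    case False
    have "\<forall>\<^sub>F x in at_right a. x < w0"
      using False by (intro eventually_at_right_real[THEN eventually_mono]) auto
    then have "\<forall>\<^sub>F x in at_right a. 0 = weight_cdf \<beta> w0 x"
      by eventually_elim (simp add: weight_cdf_def)
    then have "(weight_cdf \<beta> w0 \<longlongrightarrow> 0) (at_right a)"
      by (rule Lim_transform_eventually[OF tendsto_const])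
    then show ?thesis using False by (simp add: continuous_within weight_cdf_def)
  qed
  have "\<forall>\<^sub>F x in at_bot. 0 = weight_cdf \<beta> w0 x"
    using eventually_gt_at_bot[of w0]
    by eventually_elim (simp add: weight_cdf_def)
  then have bot: "(weight_cdf \<beta> w0 \<longlongrightarrow> 0) at_bot"
    by (rule Lim_transform_eventually[OF tendsto_const])
  have "filterlim (\<lambda>x. x / w0) at_top at_top"
    using assms filterlim_tendsto_pos_mult_at_top[OF tendsto_const[of "1 / w0"] _ filterlim_ident]
    by simp
  then have "((\<lambda>x. 1 - (x / w0) powr (1 - \<beta>)) \<longlongrightarrow> 1 - 0) at_top"
    using assms by (intro tendsto_diff tendsto_const tendsto_neg_powr) auto
  moreover have "\<forall>\<^sub>F x in at_top. 1 - (x / w0) powr (1 - \<beta>) = weight_cdf \<beta> w0 x"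
    using eventually_ge_at_top[of w0] by eventually_elim (simp add: weight_cdf_def)
  ultimately have top: "(weight_cdf \<beta> w0 \<longlongrightarrow> 1) at_top"
    using Lim_transform_eventually by fastforce
  show "real_distribution (weight_measure \<beta> w0)" "cdf (weight_measure \<beta> w0) = weight_cdf \<beta> w0"
    unfolding weight_measure_def
    using mono rc bot top
    by (auto intro!: real_distribution_interval_measure cdf_interval_measure)
qed

definition torus :: "(real ^ 'd) set" where
  "torus = {x. \<forall>i. 0 \<le> x $ i \<and> x $ i < 1}"

text \<open>The torus has Lebesgue measure 1, so the restriction is the uniform distribution.\<close>

definition torus_measure :: "(real ^ 'd) measure" where
  "torus_measure = restrict_space lborel torus"

lemma torus_sets: "(torus :: (real ^ 'd) set) \<in> sets borel"
  unfolding torus_def by measurable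

lemma prob_space_torus_measure: "prob_space (torus_measure :: (real ^ 'd) measure)"
proof
  have "emeasure lborel (torus :: (real ^ 'd) set) \<le> emeasure lborel (cbox 0 (1 :: real ^ 'd))"
    by (intro emeasure_mono) (auto simp: torus_def mem_box_cart less_imp_le)
  moreover have "emeasure lborel (box 0 (1 :: real ^ 'd)) \<le> emeasure lborel (torus :: (real ^ 'd) set)"
    by (intro emeasure_mono) (auto simp: torus_def mem_box_cart less_imp_le torus_sets)
  moreover have "(1 :: real ^ 'd) \<bullet> b = 1" if "b \<in> Basis" for b
    using that by (auto simp: Basis_vec_def inner_axis)
  then have "emeasure lborel (cbox 0 (1 :: real ^ 'd)) = 1" "emeasure lborel (box 0 (1 :: real ^ 'd)) = 1"
    by (simp_all add: emeasure_lborel_cbox_eq emeasure_lborel_box_eq)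
  ultimately have "emeasure lborel (torus :: (real ^ 'd) set) = 1"
    by (metis antisym)
  then show "emeasure torus_measure (space (torus_measure :: (real ^ 'd) measure)) = 1"
    by (simp add: torus_measure_def space_restrict_space emeasure_restrict_space torus_sets)
qed

definition circle_dist :: "real \<Rightarrow> real \<Rightarrow> real" where
  "circle_dist a b = min \<bar>a - b\<bar> (1 - \<bar>a - b\<bar>)"

definition torus_dist :: "ereal \<Rightarrow> real ^ 'd \<Rightarrow> real ^ 'd \<Rightarrow> real" where
  "torus_dist p x y =
     (if p = \<infinity> then Max (range (\<lambda>i. circle_dist (x $ i) (y $ i)))
      else (\<Sum>i\<in>UNIV. circle_dist (x $ i) (y $ i) powr real_of_ereal p) powr (1 / real_of_ereal p))"

text \<open>A vertex is represented by its weight and its position; \<open>t a b\<close> is the threshold for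
  two vertices of weights \<open>a\<close> and \<open>b\<close>.\<close>

definition girg_adj ::
    "ereal \<Rightarrow> (real \<Rightarrow> real \<Rightarrow> real) \<Rightarrow> real \<times> (real ^ 'd) \<Rightarrow> real \<times> (real ^ 'd) \<Rightarrow> bool" where
  "girg_adj p t u v \<longleftrightarrow> torus_dist p (snd u) (snd v) \<le> t (fst u) (fst v)"

definition girg_clique ::
    "ereal \<Rightarrow> (real \<Rightarrow> real \<Rightarrow> real) \<Rightarrow> (nat \<Rightarrow> real \<times> (real ^ 'd)) \<Rightarrow> nat set \<Rightarrow> bool" where
  "girg_clique p t G U \<longleftrightarrow> (\<forall>u\<in>U. \<forall>v\<in>U. u \<noteq> v \<longrightarrow> girg_adj p t (G u) (G v))"

definition girg_measure :: "nat \<Rightarrow> real \<Rightarrow> real \<Rightarrow> (nat \<Rightarrow> real \<times> (real ^ 'd)) measure" where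
  "girg_measure n \<beta> w0 = Pi\<^sub>M {..<n} (\<lambda>_. weight_measure \<beta> w0 \<Otimes>\<^sub>M torus_measure)"

definition subset_measure :: "nat \<Rightarrow> nat \<Rightarrow> nat set measure" where
  "subset_measure n k = uniform_count_measure {U. U \<subseteq> {..<n} \<and> card U = k}"

text \<open>Since positions are independent of weights, the probability that two vertices are adjacent
  given that their weights are \<open>a\<close> and \<open>b\<close> is a probability over the two positions only.
  For weight products of at least \<open>n / \<Lambda>\<close> the condition does not determine \<open>t\<close> uniquely.\<close>

definition girg_threshold ::
    "'d::finite itself \<Rightarrow> nat \<Rightarrow> real \<Rightarrow> real \<Rightarrow> ereal \<Rightarrow> (real \<Rightarrow> real \<Rightarrow> real) \<Rightarrow> bool" where
  "girg_threshold _ n \<Lambda> w0 p t \<longleftrightarrow>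
     (\<forall>a\<ge>w0. \<forall>b\<ge>w0.
        \<P>(z in torus_measure \<Otimes>\<^sub>M (torus_measure :: (real ^ 'd) measure).
            girg_adj p t (a, fst z) (b, snd z)) = min 1 (\<Lambda> * a * b / real n))"

end

theory Submission
  imports Defs
begin

text \<open>Let \<open>u\<close> be the lightest of the \<open>k\<close> chosen vertices and \<open>w \<le> w_plus\<close> its weight. If all others lie
  within half the threshold distance of two vertices of weight \<open>w\<close> from \<open>u\<close>, the triangle inequality
  makes the set a clique. On the torus the ball of radius \<open>r\<close> has the same volume around every point,
  and halving \<open>r\<close> costs at most a factor \<open>2 ^ d\<close>, so each other vertex satisfies this with probability
  at least \<open>\<Lambda> w\<^sup>2 / (n 2 ^ d)\<close>. Integrating against the density of the minimum of \<open>k\<close> weights gives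
  the bound.

  The thresholds \<open>t a b\<close> are not assumed measurable. The volume of a ball is strictly increasing in
  its radius up to the diameter of the torus, so adjacency is equivalent to an inequality between
  ball volumes, which is measurable in weights and positions.\<close>

subsection \<open>Circle distance and \<open>L\<^sub>p\<close> norms\<close>


text \<open>Distance to the nearest integer. It extends \<open>circle_dist\<close> from differences
  of points of [0,1) to all reals, where periodicity and the triangle inequality follow from the
  minimality of \<open>round\<close>.\<close>

definition round_dist :: "real \<Rightarrow> real" where
  "round_dist z = \<bar>z - of_int (round z)\<bar>"

lemma round_dist_le: "round_dist z \<le> \<bar>z - of_int m\<bar>"
  unfolding round_dist_def by (rule round_diff_minimal)

lemma round_dist_nonneg: "0 \<le> round_dist z"
  by (simp add: round_dist_def)

lemma round_dist_le_half: "round_dist z \<le> 1 / 2"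
  unfolding round_dist_def using of_int_round_abs_le[of z] by linarith

lemma round_dist_uminus: "round_dist (- z) = round_dist z"
proof -
  have "round_dist (- z) \<le> round_dist z" for z
    using round_dist_le[of "- z" "- round z"] by (simp add: round_dist_def abs_minus_commute)
  from this[of z] this[of "- z"] show ?thesis by simp
qed

lemma round_dist_add_int: "round_dist (z + of_int m) = round_dist z"
proof -
  have "round_dist (z + of_int m) \<le> round_dist z" for z m
    using round_dist_le[of "z + of_int m" "round z + m"] by (simp add: round_dist_def)
  from this[of z m] this[of "z + of_int m" "- m"] show ?thesis by simp
qed

lemma round_dist_triangle: "round_dist (a + b) \<le> round_dist a + round_dist b"
  using round_dist_le[of "a + b" "round a + round b"] unfolding round_dist_def by simp

lemma round_dist_eq_abs:
  assumes "\<bar>z\<bar> \<le> 1 / 2"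
  shows "round_dist z = \<bar>z\<bar>"
proof (rule antisym)
  show "round_dist z \<le> \<bar>z\<bar>" using round_dist_le[of z 0] by simp
  show "\<bar>z\<bar> \<le> round_dist z"
  proof (cases "round z = 0")
    case False
    then have "1 \<le> \<bar>round z\<bar>" by linarith
    then have "1 \<le> \<bar>of_int (round z) :: real\<bar>" by linarith
    then show ?thesis unfolding round_dist_def using assms by linarith
  qed (simp add: round_dist_def)
qed

lemma borel_measurable_round_dist [measurable]: "round_dist \<in> borel_measurable borel"
  unfolding round_dist_def round_def by measurable

lemma circle_dist_eq_round_dist:
  assumes "0 \<le> a" "a < 1" "0 \<le> b" "b < 1"
  shows "circle_dist a b = round_dist (a - b)"
proof -
  have sym: "round_dist (a - b) = round_dist \<bar>a - b\<bar>"
    using round_dist_uminus[of "a - b"] by (cases "a \<le> b") auto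
  show ?thesis
  proof (cases "\<bar>a - b\<bar> \<le> 1 / 2")
    case True
    then show ?thesis by (auto simp: circle_dist_def round_dist_eq_abs)
  next
    case False
    \<comment> \<open>Beyond one half the nearest integer is 1; subtracting it moves the argument
      into the range where \<open>round_dist\<close> is the absolute value.\<close>
    have "round_dist \<bar>a - b\<bar> = round_dist (\<bar>a - b\<bar> - 1)"
      using round_dist_add_int[of "\<bar>a - b\<bar> - 1" 1] by simp
    also have "\<dots> = \<bar>\<bar>a - b\<bar> - 1\<bar>"
      using False assms by (intro round_dist_eq_abs) linarith
    finally show ?thesis using False assms sym by (auto simp: circle_dist_def)
  qed
qed

text \<open>Repeats the case split of \<open>torus_dist\<close>, so that the torus distance is this
  norm of the vector of circle distances.\<close>

definition lp_norm :: "ereal \<Rightarrow> real ^ 'd \<Rightarrow> real" where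
  "lp_norm p v =
     (if p = \<infinity> then Max (range (\<lambda>i. \<bar>v $ i\<bar>))
      else (\<Sum>i\<in>UNIV. \<bar>v $ i\<bar> powr real_of_ereal p) powr (1 / real_of_ereal p))"

lemma borel_measurable_lp_norm [measurable]: "lp_norm p \<in> borel_measurable borel"
  unfolding lp_norm_def by (cases "p = \<infinity>") (simp_all, measurable)

lemma lp_norm_infinity_le_iff: "lp_norm \<infinity> v \<le> r \<longleftrightarrow> (\<forall>i. \<bar>v $ i\<bar> \<le> r)"
  by (simp add: lp_norm_def)

lemma lp_norm_nonneg: "0 \<le> lp_norm p v"
proof (cases "p = \<infinity>")
  case True
  have "\<bar>v $ i\<bar> \<le> lp_norm \<infinity> v" for i
    using lp_norm_infinity_le_iff[of v "lp_norm \<infinity> v"] by simp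
  from order_trans[OF abs_ge_zero this] show ?thesis using True by simp
qed (simp add: lp_norm_def)

lemma lp_norm_mono:
  assumes "1 \<le> p" "\<And>i. \<bar>u $ i\<bar> \<le> \<bar>v $ i\<bar>"
  shows "lp_norm p u \<le> lp_norm p v"
proof (cases "p = \<infinity>")
  case True
  then show ?thesis
    using assms(2) lp_norm_infinity_le_iff[of v "lp_norm p v"]
    by (auto simp: lp_norm_infinity_le_iff intro: order_trans)
next
  case False
  then have "1 \<le> real_of_ereal p"
    using assms(1) by (cases p) auto
  then show ?thesis using False assms(2)
    by (auto simp: lp_norm_def intro!: powr_mono2 sum_mono sum_nonneg)
qed

lemma lp_norm_scale:
  assumes "1 \<le> p" "0 \<le> c"
  shows "lp_norm p (c *\<^sub>R v) = c * lp_norm p v"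
proof (cases "p = \<infinity>")
  case True
  have "Max (range (\<lambda>i. c * \<bar>v $ i\<bar>)) = c * Max (range (\<lambda>i. \<bar>v $ i\<bar>))"
    using mono_Max_commute[of "\<lambda>x. c * x" "range (\<lambda>i. \<bar>v $ i\<bar>)"] assms(2)
    by (simp add: mono_def mult_left_mono image_image)
  then show ?thesis using True assms by (simp add: lp_norm_def abs_mult)
next
  case False
  define q where "q = real_of_ereal p"
  have q: "1 \<le> q" using False assms(1) unfolding q_def by (cases p) auto
  have "(\<Sum>i\<in>UNIV. \<bar>(c *\<^sub>R v) $ i\<bar> powr q) = c powr q * (\<Sum>i\<in>UNIV. \<bar>v $ i\<bar> powr q)"
    using assms(2) by (simp add: abs_mult powr_mult sum_distrib_left)
  then show ?thesis using False q assms(2)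
    by (simp add: lp_norm_def powr_mult powr_powr sum_nonneg flip: q_def)
qed

text \<open>For positive arguments this is convexity of \<open>x powr q\<close>; if one argument is
  0, it reduces to \<open>l powr q \<le> l\<close> for \<open>0 < l \<le> 1\<close>.\<close>

lemma powr_convex_combination:
  fixes x y q l m :: real
  assumes "1 \<le> q" "0 \<le> x" "0 \<le> y" "0 < l" "0 < m" "l + m = 1"
  shows "(l * x + m * y) powr q \<le> l * x powr q + m * y powr q"
proof -
  have less: "l powr q \<le> l" if "0 < l" "l \<le> 1" for l :: real
    using powr_mono'[of 1 q l] that assms(1) by simp
  consider "x = 0" | "y = 0" | "0 < x" "0 < y" using assms by linarith
  then show ?thesis
  proof cases
    case 1
    then show ?thesis using less[of m] assms by (simp add: powr_mult mult_right_mono)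
  next
    case 2
    then show ?thesis using less[of l] assms by (simp add: powr_mult mult_right_mono)
  next
    case 3
    then show ?thesis
      using convex_onD[OF powr_convex[OF assms(1)], of m x y] assms
      by (simp add: eq_diff_eq[symmetric])
  qed
qed

lemma lp_norm_eq_0D:
  assumes "1 \<le> p" "lp_norm p v = 0"
  shows "v = 0"
proof (cases "p = \<infinity>")
  case True
  then show ?thesis using assms(2) lp_norm_infinity_le_iff[of v 0] by (simp add: vec_eq_iff)
next
  case False
  then show ?thesis using assms
    by (auto simp: lp_norm_def vec_eq_iff sum_nonneg_eq_0_iff sum_nonneg)
qed

text \<open>Minkowski's inequality: the unit ball is convex because \<open>x powr q\<close> is.\<close>

lemma lp_norm_triangle:
  assumes "1 \<le> p"
  shows "lp_norm p (u + v) \<le> lp_norm p u + lp_norm p v"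
proof (cases "p = \<infinity>")
  case True
  then show ?thesis
    using lp_norm_infinity_le_iff[of u "lp_norm p u"] lp_norm_infinity_le_iff[of v "lp_norm p v"]
    by (auto simp: lp_norm_infinity_le_iff intro: order_trans[OF abs_triangle_ineq add_mono])
next
  case False
  define q where "q = real_of_ereal p"
  have q: "1 \<le> q" using False assms(1) unfolding q_def by (cases p) auto
  define a b where "a = lp_norm p u" and "b = lp_norm p v"
  \<comment> \<open>A vector of norm 0 vanishes and the claim is trivial; otherwise both vectors can
    be normalised by dividing by \<open>a\<close> and \<open>b\<close>.\<close>
  consider "u = 0" | "v = 0" | "0 < a" "0 < b"
    using lp_norm_eq_0D[OF assms, of u] lp_norm_eq_0D[OF assms, of v]
      lp_norm_nonneg[of p u] lp_norm_nonneg[of p v] unfolding a_def b_def by force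
  then show ?thesis
  proof cases
    case 3
    then have ab: "a + b \<noteq> 0" by linarith
    have S: "(\<Sum>i\<in>UNIV. \<bar>w $ i\<bar> powr q) = lp_norm p w powr q" for w :: "real ^ 'a"
      using False q by (simp add: lp_norm_def powr_powr sum_nonneg flip: q_def)
    \<comment> \<open>Per coordinate, \<open>\<bar>u $ i\<bar> + \<bar>v $ i\<bar>\<close> is
      \<open>a + b\<close> times a convex combination of the normalised entries. After summation
      each normalised vector contributes exactly its weight, because its q-th powers sum to
      1.\<close>
    have "(\<Sum>i\<in>UNIV. \<bar>(u + v) $ i\<bar> powr q)
        \<le> (\<Sum>i\<in>UNIV. (a + b) powr q * (a / (a + b) * (\<bar>u $ i\<bar> / a) powr q + b / (a + b) * (\<bar>v $ i\<bar> / b) powr q))"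
    proof (rule sum_mono)
      fix i
      have "\<bar>(u + v) $ i\<bar> powr q \<le> (\<bar>u $ i\<bar> + \<bar>v $ i\<bar>) powr q"
        using q by (intro powr_mono2) auto
      also have "\<bar>u $ i\<bar> + \<bar>v $ i\<bar> = (a + b) * (a / (a + b) * (\<bar>u $ i\<bar> / a) + b / (a + b) * (\<bar>v $ i\<bar> / b))"
        using 3 ab by (simp add: distrib_left)
      also have "\<dots> powr q = (a + b) powr q * (a / (a + b) * (\<bar>u $ i\<bar> / a) + b / (a + b) * (\<bar>v $ i\<bar> / b)) powr q"
        by (rule powr_mult)
      also have "\<dots> \<le> (a + b) powr q * (a / (a + b) * (\<bar>u $ i\<bar> / a) powr q + b / (a + b) * (\<bar>v $ i\<bar> / b) powr q)"
        using 3 q by (intro mult_left_mono powr_convex_combination) (auto simp flip: add_divide_distrib)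
      finally show "\<bar>(u + v) $ i\<bar> powr q \<le> \<dots>" .
    qed
    also have "\<dots> = (a + b) powr q * (a / (a + b) * ((\<Sum>i\<in>UNIV. \<bar>u $ i\<bar> powr q) / a powr q)
        + b / (a + b) * ((\<Sum>i\<in>UNIV. \<bar>v $ i\<bar> powr q) / b powr q))"
      using 3 by (simp add: powr_divide sum.distrib sum_distrib_left sum_divide_distrib distrib_left)
    also have "\<dots> = (a + b) powr q"
      using 3 unfolding S by (simp flip: a_def b_def add_divide_distrib)
    finally have "lp_norm p (u + v) powr q \<le> (a + b) powr q" unfolding S .
    then show ?thesis
      using q 3 powr_less_mono2[of q "a + b" "lp_norm p (u + v)"]
      by (fold a_def b_def) fastforce
  qed (auto simp: lp_norm_nonneg)
qed

subsection \<open>Volumes of balls\<close>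


text \<open>Half-open, so that its translates by integer vectors tile the space without
  overlap.\<close>

definition unit_box :: "real ^ 'd \<Rightarrow> (real ^ 'd) set" where
  "unit_box a = {y. \<forall>i. a $ i \<le> y $ i \<and> y $ i < a $ i + 1}"

lemma unit_box_sets [measurable]: "unit_box a \<in> sets borel"
  unfolding unit_box_def by measurable

lemma torus_eq_unit_box: "torus = unit_box 0"
  by (simp add: torus_def unit_box_def)

definition int_vec :: "('d \<Rightarrow> int) \<Rightarrow> real ^ 'd" where
  "int_vec k = (\<chi> i. of_int (k i))"

text \<open>In each coordinate the floor of \<open>y $ i - b $ i\<close> is the only admissible
  integer.\<close>

lemma ex1_int_vec_unit_box: "\<exists>!k. y - int_vec k \<in> unit_box b"
proof
  show "y - int_vec (\<lambda>i. \<lfloor>y $ i - b $ i\<rfloor>) \<in> unit_box b"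
    by (auto simp: unit_box_def int_vec_def) linarith+
next
  fix k assume "y - int_vec k \<in> unit_box b"
  then have *: "b $ i \<le> y $ i - of_int (k i) \<and> y $ i - of_int (k i) < b $ i + 1" for i
    by (simp add: unit_box_def int_vec_def)
  have "\<lfloor>y $ i - b $ i\<rfloor> = k i" for i
    using *[of i] by (intro floor_unique) linarith+
  then show "k = (\<lambda>i. \<lfloor>y $ i - b $ i\<rfloor>)" by auto
qed

lemma emeasure_lborel_translate:
  fixes A :: "'a::euclidean_space set"
  assumes "A \<in> sets borel"
  shows "emeasure lborel {y. y + c \<in> A} = emeasure lborel A"
proof -
  have "emeasure lborel A = emeasure (distr lborel borel ((+) c)) A"
    by (simp add: lborel_distr_plus)
  also have "\<dots> = emeasure lborel {y. y + c \<in> A}"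
    using assms by (simp add: emeasure_distr vimage_def add.commute)
  finally show ?thesis ..
qed

text \<open>Both unit boxes are fundamental domains of the lattice of integer vectors, so cutting one
  along the translates of the other and moving the pieces back preserves the measure.\<close>

lemma emeasure_periodic_Int_unit_box:
  fixes S :: "(real ^ 'd) set"
  assumes [measurable]: "S \<in> sets borel"
    and periodic: "\<And>y k. y + int_vec k \<in> S \<longleftrightarrow> y \<in> S"
  shows "emeasure lborel (S \<inter> unit_box a) = emeasure lborel (S \<inter> unit_box b)"
proof -
  \<comment> \<open>\<open>X k\<close> is the piece of \<open>unit_box a\<close> that the shift by
    \<open>- int_vec k\<close> carries into \<open>unit_box b\<close>; \<open>Y k\<close> is where
    it lands.\<close>
  define X where "X k = {y. y \<in> S \<and> y \<in> unit_box a \<and> y - int_vec k \<in> unit_box b}" for k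
  define Y where "Y k = {y. y \<in> S \<and> y + int_vec k \<in> unit_box a \<and> y \<in> unit_box b}" for k
  have [measurable]: "X k \<in> sets borel" "Y k \<in> sets borel" for k
    unfolding X_def Y_def by measurable
  have shift_minus: "y + int_vec k \<in> unit_box a \<longleftrightarrow> y - int_vec (\<lambda>i. - k i) \<in> unit_box a" for y k
  proof -
    have "y + int_vec k = y - int_vec (\<lambda>i. - k i)" by (simp add: int_vec_def vec_eq_iff)
    then show ?thesis by simp
  qed
  have disjX: "disjoint_family X"
    using ex1_int_vec_unit_box[of _ b] by (auto simp: disjoint_family_on_def X_def)
  have disjY: "disjoint_family Y"
  proof -
    have False if "y \<in> Y k" "y \<in> Y l" "k \<noteq> l" for y k l
    proof -
      have "(\<lambda>i. - k i) = (\<lambda>i. - l i)"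
        using that ex1_int_vec_unit_box[of y a] by (auto simp: Y_def shift_minus)
      then show False using \<open>k \<noteq> l\<close> by (auto simp: fun_eq_iff)
    qed
    then show ?thesis by (auto simp: disjoint_family_on_def)
  qed
  have "S \<inter> unit_box a = (\<Union>k. X k)"
    using ex1_implies_ex[OF ex1_int_vec_unit_box[of _ b]] by (auto simp: X_def)
  moreover have "S \<inter> unit_box b = (\<Union>k. Y k)"
  proof -
    have "\<exists>k. y + int_vec k \<in> unit_box a" for y
    proof -
      obtain k where "y - int_vec k \<in> unit_box a" using ex1_int_vec_unit_box[of y a] by blast
      then show ?thesis by (intro exI[of _ "\<lambda>i. - k i"]) (simp add: shift_minus)
    qed
    then show ?thesis by (auto simp: Y_def)
  qed
  moreover have "emeasure lborel (X k) = emeasure lborel (Y k)" for k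
  proof -
    have "Y k = {y. y + int_vec k \<in> X k}"
      unfolding X_def Y_def by (auto simp: periodic)
    then show ?thesis using emeasure_lborel_translate[of "X k" "int_vec k"] by simp
  qed
  ultimately show ?thesis
    using emeasure_UN_countable[of UNIV X lborel] emeasure_UN_countable[of UNIV Y lborel] disjX disjY
    by simp
qed

text \<open>Volume of a torus ball of radius \<open>r\<close>, computed in the cube centred at 0,
  where the torus distance to the centre is the plain norm. The type argument carries the
  dimension.\<close>

definition ball_vol :: "'d::finite itself \<Rightarrow> ereal \<Rightarrow> real \<Rightarrow> real" where
  "ball_vol _ p r = measure lborel {v :: real ^ 'd. v \<in> unit_box (\<chi> i. - 1 / 2) \<and> lp_norm p v \<le> r}"

lemma emeasure_unit_box: "emeasure lborel (unit_box (a :: real ^ 'd)) = 1"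
proof -
  have "emeasure lborel (unit_box a) = emeasure lborel (torus :: (real ^ 'd) set)"
    using emeasure_periodic_Int_unit_box[of UNIV a 0] by (simp add: torus_eq_unit_box)
  also have "\<dots> = 1"
    using prob_space.emeasure_space_1[OF prob_space_torus_measure[where 'd='d]]
    by (simp add: torus_measure_def space_restrict_space emeasure_restrict_space torus_sets)
  finally show ?thesis .
qed

lemma emeasure_ball_vol:
  "emeasure lborel {v :: real ^ 'd. v \<in> unit_box (\<chi> i. - 1 / 2) \<and> lp_norm p v \<le> r}
     = ennreal (ball_vol TYPE('d) p r)"
  unfolding ball_vol_def
proof (rule emeasure_eq_ennreal_measure)
  have "emeasure lborel {v :: real ^ 'd. v \<in> unit_box (\<chi> i. - 1 / 2) \<and> lp_norm p v \<le> r}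
      \<le> emeasure lborel (unit_box (\<chi> i. - 1 / 2) :: (real ^ 'd) set)"
    by (intro emeasure_mono) auto
  then show "emeasure lborel {v :: real ^ 'd. v \<in> unit_box (\<chi> i. - 1 / 2) \<and> lp_norm p v \<le> r} \<noteq> top"
    by (auto simp: emeasure_unit_box top_unique)
qed

lemma ball_vol_mono:
  assumes "r \<le> s"
  shows "ball_vol TYPE('d::finite) p r \<le> ball_vol TYPE('d) p s"
proof -
  have "ennreal (ball_vol TYPE('d) p r) \<le> ennreal (ball_vol TYPE('d) p s)"
    unfolding emeasure_ball_vol[symmetric] using assms by (intro emeasure_mono) auto
  then show ?thesis by (simp add: ball_vol_def)
qed

lemma ball_vol_eq_0_of_neg:
  assumes "r < 0"
  shows "ball_vol TYPE('d::finite) p r = 0"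
proof -
  have "\<not> lp_norm p v \<le> r" for v :: "real ^ 'd"
    using lp_norm_nonneg[of p v] assms by linarith
  then show ?thesis by (simp add: ball_vol_def)
qed

text \<open>Halving maps the truncated ball of radius \<open>r\<close> into the one of radius
  \<open>r / 2\<close>, since the norm is homogeneous and the cube is star-shaped about 0, and it
  divides the volume by \<open>2 ^ d\<close>. Truncation by the cube is why only an inequality
  holds.\<close>

lemma ball_vol_half:
  assumes "1 \<le> p"
  shows "ball_vol TYPE('d::finite) p r / 2 ^ CARD('d) \<le> ball_vol TYPE('d) p (r / 2)"
proof -
  define K where "K r = {v :: real ^ 'd. v \<in> unit_box (\<chi> i. - 1 / 2) \<and> lp_norm p v \<le> r}" for r
  have [measurable]: "K r \<in> sets borel" for r unfolding K_def by measurable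
  have "lborel = density (distr lborel borel (\<lambda>x :: real ^ 'd. 0 + (1 / 2) *\<^sub>R x)) (\<lambda>_. ennreal (\<bar>1 / 2\<bar> ^ DIM(real ^ 'd)))"
    by (rule lborel_affine) simp
  then have "emeasure lborel (K (r / 2)) = emeasure \<dots> (K (r / 2))" by simp
  also have "\<dots> = ennreal ((1 / 2) ^ CARD('d)) * emeasure lborel {v. (1 / 2) *\<^sub>R v \<in> K (r / 2)}"
    by (simp add: emeasure_density emeasure_distr nn_integral_cmult vimage_def)
  also have "\<dots> \<ge> ennreal ((1 / 2) ^ CARD('d)) * emeasure lborel (K r)"
  proof (intro mult_left_mono emeasure_mono)
    show "K r \<subseteq> {v. (1 / 2) *\<^sub>R v \<in> K (r / 2)}"
    proof
      fix v assume v: "v \<in> K r"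
      have "- (1 / 2) \<le> v $ i / 2 \<and> v $ i / 2 < - (1 / 2) + 1" for i
      proof -
        have "- (1 / 2) \<le> v $ i \<and> v $ i < - (1 / 2) + 1" using v by (simp add: K_def unit_box_def)
        then show ?thesis by linarith
      qed
      then show "v \<in> {v. (1 / 2) *\<^sub>R v \<in> K (r / 2)}"
        using v assms by (simp add: K_def lp_norm_scale unit_box_def)
    qed
  qed (auto)
  finally show ?thesis
    unfolding K_def emeasure_ball_vol
    by (simp add: ball_vol_def power_one_over flip: ennreal_mult)
qed

text \<open>Every radius \<open>s\<close> attained by \<open>lp_norm\<close> on the cube of vectors with entries in \<open>[0, 1/2]\<close>
  is a point of increase: shrinking the vector slightly yields an interior point of the cube
  whose norm, and that of all nearby points, lies between \<open>r\<close> and \<open>s\<close>.\<close>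

lemma ball_vol_strict_mono:
  fixes v :: "real ^ 'd"
  assumes p: "1 \<le> p" and v: "\<And>i. 0 \<le> v $ i \<and> v $ i \<le> 1 / 2" and r: "0 \<le> r" "r < lp_norm p v"
  shows "ball_vol TYPE('d) p r < ball_vol TYPE('d) p (lp_norm p v)"
proof -
  define s where "s = lp_norm p v"
  define K where "K r = {v :: real ^ 'd. v \<in> unit_box (\<chi> i. - 1 / 2) \<and> lp_norm p v \<le> r}" for r
  have [measurable]: "K r \<in> sets borel" for r unfolding K_def by measurable
  \<comment> \<open>Chosen so that \<open>c * s\<close> is the midpoint of \<open>r\<close> and
    \<open>s\<close>; the shrunk vector \<open>q\<close> then has norm strictly between
    them.\<close>
  define c where "c = (r + s) / (2 * s)"
  have s: "0 < s" "r < s" using r by (auto simp: s_def)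
  have c: "0 \<le> c" "c < 1" "r < c * s" using s r by (auto simp: c_def field_simps)
  define q where "q = c *\<^sub>R v"
  have Nq: "lp_norm p q = c * s" using c p by (simp add: q_def s_def lp_norm_scale)
  \<comment> \<open>The norm \<open>N\<close> of the all-ones vector controls perturbations: if
    every entry moves by less than \<open>e\<close>, then \<open>lp_norm p\<close> changes by at
    most \<open>e * N\<close>.\<close>
  define o1 :: "real ^ 'd" where "o1 = (\<chi> i. 1)"
  define N where "N = lp_norm p o1"
  have "o1 \<noteq> 0" by (auto simp: o1_def vec_eq_iff)
  then have N: "0 < N"
    using lp_norm_eq_0D[OF p, of o1] lp_norm_nonneg[of p o1] unfolding N_def by force
  have cs: "c * s < s" using c s by simp
  \<comment> \<open>The first upper bound keeps the box of half-width \<open>e\<close> around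
    \<open>q\<close> inside the cube, as the entries of \<open>q\<close> are at most
    \<open>c / 2\<close>; the other two keep all norms in it strictly between \<open>r\<close> and
    \<open>s\<close>.\<close>
  obtain e where e: "0 < e" "e \<le> (1 - c) / 2" "e \<le> (c * s - r) / (2 * N)" "e \<le> (s - c * s) / (2 * N)"
  proof
    let ?M = "Min {(1 - c) / 2, (c * s - r) / (2 * N), (s - c * s) / (2 * N)}"
    show "0 < ?M" using c N cs by simp
    show "?M \<le> (1 - c) / 2" "?M \<le> (c * s - r) / (2 * N)" "?M \<le> (s - c * s) / (2 * N)"
      by (rule Min_le; simp)+
  qed
  have eN: "e * N < c * s - r" "e * N < s - c * s"
    using e(3,4) N c cs by (auto simp: field_simps)
  define B where "B = box (q - e *\<^sub>R o1) (q + e *\<^sub>R o1)"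
  have B: "\<bar>u $ i - q $ i\<bar> < e" if "u \<in> B" for u i
    using that by (auto simp: B_def mem_box_cart o1_def abs_less_iff algebra_simps)
  have norm_near: "lp_norm p x \<le> lp_norm p y + e * N" if "\<And>i. \<bar>x $ i - y $ i\<bar> < e" for x y :: "real ^ 'd"
  proof -
    have "lp_norm p x \<le> lp_norm p y + lp_norm p (x - y)"
      using lp_norm_triangle[OF p, of y "x - y"] by simp
    also have "lp_norm p (x - y) \<le> lp_norm p (e *\<^sub>R o1)"
      using that e by (intro lp_norm_mono[OF p]) (auto simp: o1_def less_imp_le)
    also have "lp_norm p (e *\<^sub>R o1) = e * N" using e p by (simp add: lp_norm_scale N_def)
    finally show ?thesis by simp
  qed
  have BK: "B \<subseteq> K s - K r"
  proof
    fix u assume u: "u \<in> B"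
    have "lp_norm p u \<le> c * s + e * N" using norm_near[of u q] B[OF u] Nq by simp
    moreover have "c * s \<le> lp_norm p u + e * N"
      using norm_near[of q u] B[OF u] Nq by (simp add: abs_minus_commute)
    moreover have "u \<in> unit_box (\<chi> i. - 1 / 2)"
    proof -
      have "0 \<le> q $ i \<and> q $ i \<le> c / 2" for i
        using v[of i] c mult_left_mono[of "v $ i" "1/2" c] by (simp add: q_def)
      then have "- (1 / 2) \<le> u $ i \<and> u $ i < - (1 / 2) + 1" for i
        using B[OF u, of i] e(2) by (smt (verit, best) field_sum_of_halves diff_divide_distrib)
      then show ?thesis by (simp add: unit_box_def)
    qed
    ultimately show "u \<in> K s - K r" using eN by (auto simp: K_def)
  qed
  have "0 < emeasure lborel B"
  proof -
    have o1: "o1 \<bullet> b = 1" if "b \<in> Basis" for b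
      using that by (auto simp: o1_def Basis_vec_def inner_axis)
    have "emeasure lborel B = (\<Prod>b\<in>Basis. (q + e *\<^sub>R o1 - (q - e *\<^sub>R o1)) \<bullet> b)"
      unfolding B_def using e o1
      by (intro emeasure_lborel_box) (simp add: inner_diff_left inner_add_left)
    also have "(\<Prod>b\<in>Basis. (q + e *\<^sub>R o1 - (q - e *\<^sub>R o1)) \<bullet> b) = (\<Prod>b\<in>(Basis :: (real ^ 'd) set). 2 * e)"
    proof (intro prod.cong refl)
      fix b :: "real ^ 'd" assume "b \<in> Basis"
      from o1[OF this] show "(q + e *\<^sub>R o1 - (q - e *\<^sub>R o1)) \<bullet> b = 2 * e"
        unfolding inner_diff_left inner_add_left inner_scaleR_left by simp
    qed
    finally show ?thesis using e by simp
  qed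
  also have "emeasure lborel B \<le> emeasure lborel (K s - K r)"
    using BK by (intro emeasure_mono) auto
  finally have "0 < emeasure lborel (K s - K r)" .
  moreover have "emeasure lborel (K s - K r) = emeasure lborel (K s) - emeasure lborel (K r)"
    using s emeasure_ball_vol[where 'd='d, of p] by (intro emeasure_Diff) (auto simp: K_def)
  ultimately have "ennreal (ball_vol TYPE('d) p r) < ennreal (ball_vol TYPE('d) p s)"
    unfolding K_def emeasure_ball_vol by (simp add: diff_gt_0_iff_gt_ennreal)
  then show ?thesis by (simp add: s_def ball_vol_def ennreal_less_iff)
qed

subsection \<open>Distances on the torus and adjacency\<close>


text \<open>Agrees with \<open>torus_dist\<close> on the torus, but is invariant under integer
  translations on the whole space, which allows balls to be recentred.\<close>

definition periodic_dist :: "ereal \<Rightarrow> real ^ 'd \<Rightarrow> real ^ 'd \<Rightarrow> real" where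
  "periodic_dist p x y = lp_norm p (\<chi> i. round_dist (x $ i - y $ i))"

lemma torus_dist_eq_periodic_dist:
  assumes "x \<in> torus" "y \<in> torus"
  shows "torus_dist p x y = periodic_dist p x y"
proof -
  have "circle_dist (x $ i) (y $ i) = \<bar>round_dist (x $ i - y $ i)\<bar>" for i
    using assms by (simp add: torus_def circle_dist_eq_round_dist round_dist_nonneg)
  then show ?thesis by (simp add: torus_dist_def periodic_dist_def lp_norm_def)
qed

lemma borel_measurable_periodic_dist [measurable]:
  assumes [measurable]: "f \<in> borel_measurable M" "g \<in> borel_measurable M"
  shows "(\<lambda>x. periodic_dist p (f x) (g x)) \<in> borel_measurable M"
proof -
  have [measurable]: "(\<lambda>x. f x $ i) \<in> borel_measurable M" "(\<lambda>x. g x $ i) \<in> borel_measurable M" for i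
    by (auto intro: measurable_compose[OF assms(1)] measurable_compose[OF assms(2)])
  show ?thesis
    unfolding periodic_dist_def lp_norm_def by (cases "p = \<infinity>") (simp_all, measurable)
qed

lemma periodic_dist_nonneg: "0 \<le> periodic_dist p x y"
  by (simp add: periodic_dist_def lp_norm_nonneg)

lemma periodic_dist_commute: "periodic_dist p x y = periodic_dist p y x"
  using round_dist_uminus[of "x $ i - y $ i" for i] by (simp add: periodic_dist_def)

lemma periodic_dist_triangle:
  assumes "1 \<le> p"
  shows "periodic_dist p x z \<le> periodic_dist p x y + periodic_dist p y z"
proof -
  have "periodic_dist p x z
      \<le> lp_norm p ((\<chi> i. round_dist (x $ i - y $ i)) + (\<chi> i. round_dist (y $ i - z $ i)))"
    unfolding periodic_dist_def
  proof (rule lp_norm_mono[OF assms])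
    fix i
    have "round_dist (x $ i - z $ i) \<le> round_dist (x $ i - y $ i) + round_dist (y $ i - z $ i)"
      using round_dist_triangle[of "x $ i - y $ i" "y $ i - z $ i"] by simp
    then show "\<bar>(\<chi> i. round_dist (x $ i - z $ i)) $ i\<bar>
        \<le> \<bar>((\<chi> i. round_dist (x $ i - y $ i)) + (\<chi> i. round_dist (y $ i - z $ i))) $ i\<bar>"
      by (simp add: round_dist_nonneg)
  qed
  also have "\<dots> \<le> periodic_dist p x y + periodic_dist p y z"
    unfolding periodic_dist_def by (rule lp_norm_triangle[OF assms])
  finally show ?thesis .
qed

text \<open>A torus distance is the norm of a vector with entries in [0, 1/2], hence a point of
  increase of \<open>ball_vol\<close>. At radii beyond the diameter strictness fails.\<close>

lemma ball_vol_less_periodic_dist: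
  fixes x y :: "real ^ 'd"
  assumes "1 \<le> p" "0 \<le> r" "r < periodic_dist p x y"
  shows "ball_vol TYPE('d) p r < ball_vol TYPE('d) p (periodic_dist p x y)"
  using assms unfolding periodic_dist_def
  by (intro ball_vol_strict_mono conjI) (simp_all only: vec_lambda_beta round_dist_nonneg round_dist_le_half)

section \<open>Uniform measure on the torus and adjacency probabilities\<close>

lemma space_torus_measure: "space torus_measure = torus"
  by (simp add: torus_measure_def space_restrict_space)

lemma sets_torus_measure [measurable_cong]: "sets torus_measure = sets (restrict_space borel torus)"
  unfolding torus_measure_def by (rule sets_restrict_space_cong) simp

lemma measurable_ident_torus_measure [measurable]: "(\<lambda>x. x) \<in> borel_measurable torus_measure"
  by (simp add: torus_measure_def measurable_restrict_space1)

lemma emeasure_torus_ball: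
  fixes x :: "real ^ 'd"
  shows "emeasure torus_measure {y \<in> torus. periodic_dist p x y \<le> r} = ball_vol TYPE('d) p r"
proof -
  define S where "S = {y. periodic_dist p x y \<le> r}"
  have S [measurable]: "S \<in> sets borel" unfolding S_def by measurable
  have per: "y + int_vec k \<in> S \<longleftrightarrow> y \<in> S" for y k
  proof -
    have "round_dist (x $ i - (y $ i + of_int (k i))) = round_dist (x $ i - y $ i)" for i
      using round_dist_add_int[of "x $ i - y $ i" "- k i"] by (simp add: algebra_simps)
    then show ?thesis by (simp add: S_def periodic_dist_def int_vec_def)
  qed
  define h :: "real ^ 'd" where "h = (\<chi> i. - 1 / 2)"
  have "emeasure torus_measure {y \<in> torus. periodic_dist p x y \<le> r} = emeasure lborel (S \<inter> torus)"
    unfolding torus_measure_def S_def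
    by (subst emeasure_restrict_space) (auto simp: torus_sets intro!: arg_cong[where f="emeasure lborel"])
  \<comment> \<open>The ball is periodic, so the torus may be exchanged for the unit box centred at
    \<open>x\<close>; translation by \<open>x\<close> then relates it to the cube centred at
    0.\<close>
  also have "\<dots> = emeasure lborel (S \<inter> unit_box (x + h))"
    unfolding torus_eq_unit_box by (rule emeasure_periodic_Int_unit_box[OF S per])
  also have "\<dots> = emeasure lborel {v. v + x \<in> S \<inter> unit_box (x + h)}"
    by (rule emeasure_lborel_translate[symmetric]) auto
  also have "{v. v + x \<in> S \<inter> unit_box (x + h)} = {v. v \<in> unit_box h \<and> lp_norm p v \<le> r}"
  proof -
    have "lp_norm p (\<chi> i. round_dist (- (v $ i))) = lp_norm p v" if "v \<in> unit_box h" for v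
    proof -
      have "round_dist (- (v $ i)) = \<bar>v $ i\<bar>" for i
      proof -
        have "- 1 / 2 \<le> v $ i \<and> v $ i < - 1 / 2 + 1" using that by (simp add: unit_box_def h_def)
        then show ?thesis by (subst round_dist_eq_abs) linarith+
      qed
      then show ?thesis by (simp add: lp_norm_def)
    qed
    moreover have "v + x \<in> unit_box (x + h) \<longleftrightarrow> v \<in> unit_box h" for v
      by (simp add: unit_box_def algebra_simps)
    ultimately show ?thesis by (auto simp: S_def periodic_dist_def)
  qed
  also have "emeasure lborel \<dots> = ball_vol TYPE('d) p r"
    unfolding h_def by (rule emeasure_ball_vol)
  finally show ?thesis .
qed

lemma prob_torus_dist:
  "\<P>(z in torus_measure \<Otimes>\<^sub>M (torus_measure :: (real ^ 'd) measure). torus_dist p (fst z) (snd z) \<le> r)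
     = ball_vol TYPE('d) p r"
proof -
  let ?T = "torus_measure :: (real ^ 'd) measure"
  interpret T: prob_space ?T by (rule prob_space_torus_measure)
  let ?A = "{z \<in> space (?T \<Otimes>\<^sub>M ?T). torus_dist p (fst z) (snd z) \<le> r}"
  have A: "?A = {z \<in> space (?T \<Otimes>\<^sub>M ?T). periodic_dist p (fst z) (snd z) \<le> r}"
    by (auto simp: space_pair_measure space_torus_measure torus_dist_eq_periodic_dist)
  have sets: "?A \<in> sets (?T \<Otimes>\<^sub>M ?T)" unfolding A by measurable
  have "emeasure (?T \<Otimes>\<^sub>M ?T) ?A = (\<integral>\<^sup>+ x. emeasure ?T (Pair x -` ?A) \<partial>?T)"
    by (rule T.emeasure_pair_measure_alt[OF sets])
  also have "\<dots> = (\<integral>\<^sup>+ x. ball_vol TYPE('d) p r \<partial>?T)"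
  proof (rule nn_integral_cong)
    fix x assume "x \<in> space ?T"
    then have "Pair x -` ?A = {y \<in> torus. periodic_dist p x y \<le> r}"
      unfolding A by (auto simp: space_pair_measure space_torus_measure)
    then show "emeasure ?T (Pair x -` ?A) = ball_vol TYPE('d) p r"
      by (simp add: emeasure_torus_ball)
  qed
  also have "\<dots> = ball_vol TYPE('d) p r" by (simp add: T.emeasure_space_1)
  finally show ?thesis by (simp add: measure_def ball_vol_def)
qed

lemma ball_vol_threshold:
  assumes "girg_threshold TYPE('d::finite) n \<Lambda> w0 p t" "w0 \<le> a" "w0 \<le> b"
  shows "ball_vol TYPE('d) p (t a b) = min 1 (\<Lambda> * a * b / real n)"
  using assms prob_torus_dist[where 'd='d, of p "t a b"]
  by (simp add: girg_threshold_def girg_adj_def)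

text \<open>Comparing distance with threshold amounts to comparing volumes: \<open>ball_vol\<close>
  is monotone, and it rises strictly on the way up to any attained distance. This removes
  \<open>t\<close> from the criterion.\<close>

lemma girg_adj_iff_ball_vol:
  fixes x y :: "real ^ 'd"
  assumes t: "girg_threshold TYPE('d) n \<Lambda> w0 p t"
    and p: "1 \<le> p" and pos: "0 < \<Lambda>" "0 < w0" "0 < n"
    and ab: "w0 \<le> a" "w0 \<le> b" and xy: "x \<in> torus" "y \<in> torus"
  shows "girg_adj p t (a, x) (b, y)
     \<longleftrightarrow> ball_vol TYPE('d) p (periodic_dist p x y) \<le> min 1 (\<Lambda> * a * b / real n)"
proof -
  note eq = ball_vol_threshold[OF t ab]
  \<comment> \<open>A ball of negative radius is empty, so positive volume forces a nonnegative
    threshold, as strict monotonicity requires.\<close>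
  have "0 < ball_vol TYPE('d) p (t a b)" using pos ab by (simp add: eq)
  then have "0 \<le> t a b" using ball_vol_eq_0_of_neg[where 'd='d, of "t a b" p] by force
  then show ?thesis
    using ball_vol_less_periodic_dist[OF p, of "t a b" x y]
      ball_vol_mono[where 'd='d, of "periodic_dist p x y" "t a b" p]
    by (cases "t a b < periodic_dist p x y")
       (auto simp: girg_adj_def torus_dist_eq_periodic_dist[OF xy] simp flip: eq)
qed

lemma borel_measurable_ball_vol [measurable]: "ball_vol TYPE('d::finite) p \<in> borel_measurable borel"
  by (intro borel_measurable_mono monoI ball_vol_mono)

subsection \<open>The weight distribution\<close>


definition weight_density :: "real \<Rightarrow> real \<Rightarrow> real \<Rightarrow> real" where
  "weight_density \<beta> w0 x = (\<beta> - 1) * w0 powr (\<beta> - 1) * x powr (- \<beta>)"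

lemma borel_measurable_weight_density [measurable]: "weight_density \<beta> w0 \<in> borel_measurable borel"
  unfolding weight_density_def by measurable

lemma weight_cdf_eq:
  assumes "0 < w0" "w0 \<le> x"
  shows "weight_cdf \<beta> w0 x = 1 - w0 powr (\<beta> - 1) * x powr (1 - \<beta>)"
proof -
  have "w0 powr (1 - \<beta>) * w0 powr (\<beta> - 1) = 1"
    using assms by (simp flip: powr_add)
  then have "w0 powr (\<beta> - 1) = 1 / w0 powr (1 - \<beta>)"
    using assms by (simp add: field_simps)
  then show ?thesis using assms by (simp add: weight_cdf_def powr_divide)
qed

text \<open>Two real distributions with the same cdf coincide; the cdf of the density comes from the
  fundamental theorem of calculus.\<close>

lemma weight_measure_eq_density:
  assumes "0 < w0" "1 < \<beta>"
  shows "weight_measure \<beta> w0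
    = density lborel (\<lambda>x. ennreal (weight_density \<beta> w0 x) * indicator {w0..} x)" (is "_ = ?D")
proof -
  \<comment> \<open>Antiderivative of the density, equal to
    \<open>weight_cdf \<beta> w0 x - 1\<close> for \<open>x \<ge> w0\<close>: it starts at -1 and
    tends to 0.\<close>
  let ?F = "\<lambda>x. - (w0 powr (\<beta> - 1) * x powr (1 - \<beta>))"
  have F0: "?F w0 = - 1" using assms by (simp flip: powr_add)
  have deriv: "DERIV ?F x :> weight_density \<beta> w0 x" if "w0 \<le> x" for x
    using that assms unfolding weight_density_def
    by (auto intro!: derivative_eq_intros simp: algebra_simps)
  have nonneg: "0 \<le> weight_density \<beta> w0 x" for x
    using assms by (simp add: weight_density_def)
  have lim: "(?F \<longlongrightarrow> - (w0 powr (\<beta> - 1) * 0)) at_top"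
    using assms by (intro tendsto_intros tendsto_neg_powr filterlim_ident) auto
  have "emeasure ?D UNIV = (\<integral>\<^sup>+x. ennreal (weight_density \<beta> w0 x) * indicator {w0..} x \<partial>lborel)"
    by (simp add: emeasure_density)
  also have "\<dots> = ennreal (- (w0 powr (\<beta> - 1) * 0) - ?F w0)"
    by (rule nn_integral_FTC_atLeast[OF _ deriv nonneg lim]) auto
  finally have 1: "emeasure ?D UNIV = 1" unfolding F0 by simp
  interpret D: prob_space ?D by standard (use 1 in simp)
  have rd: "real_distribution ?D" by unfold_locales auto
  have "cdf ?D x = weight_cdf \<beta> w0 x" for x
  proof (cases "w0 \<le> x")
    case True
    have "emeasure ?D {..x} = (\<integral>\<^sup>+y. ennreal (weight_density \<beta> w0 y) * indicator {w0..x} y \<partial>lborel)"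
      by (auto simp: emeasure_density intro!: nn_integral_cong split: split_indicator)
    also have "\<dots> = ennreal (?F x - ?F w0)"
      using True by (intro nn_integral_FTC_Icc deriv nonneg) auto
    also have "?F x - ?F w0 = weight_cdf \<beta> w0 x"
      unfolding F0 weight_cdf_eq[OF assms(1) True] by simp
    finally show ?thesis
      using assms True powr_mono2'[of "1 - \<beta>" 1 "x / w0"] by (simp add: cdf_def measure_def weight_cdf_def)
  next
    case False
    have "emeasure ?D {..x}
        = (\<integral>\<^sup>+y. ennreal (weight_density \<beta> w0 y) * indicator {w0..} y * indicator {..x} y \<partial>lborel)"
      by (simp add: emeasure_density)
    also have "\<dots> = (\<integral>\<^sup>+(y::real). 0 \<partial>lborel)"
      by (rule nn_integral_cong) (use False in \<open>auto split: split_indicator\<close>)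
    finally show ?thesis using False by (simp add: cdf_def measure_def weight_cdf_def)
  qed
  then have "cdf (weight_measure \<beta> w0) = cdf ?D"
    by (simp add: cdf_weight_measure[OF assms] fun_eq_iff)
  then show ?thesis
    by (rule cdf_unique[OF real_distribution_weight_measure[OF assms] rd])
qed

lemma emeasure_weight_measure_greaterThan:
  assumes "0 < w0" "1 < \<beta>" "w0 \<le> w"
  shows "emeasure (weight_measure \<beta> w0) {w<..} = ennreal (w0 powr (\<beta> - 1) * w powr (1 - \<beta>))"
proof -
  interpret W: real_distribution "weight_measure \<beta> w0"
    using assms by (intro real_distribution_weight_measure) auto
  have "measure (weight_measure \<beta> w0) {w<..} = measure (weight_measure \<beta> w0) (space (weight_measure \<beta> w0) - {..w})"
    by (simp add: Compl_atMost flip: Compl_eq_Diff_UNIV)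
  also have "\<dots> = 1 - cdf (weight_measure \<beta> w0) w"
    by (subst W.prob_compl) (auto simp: cdf_def)
  also have "\<dots> = w0 powr (\<beta> - 1) * w powr (1 - \<beta>)"
    using assms by (simp add: cdf_weight_measure weight_cdf_eq)
  finally show ?thesis by (simp add: W.emeasure_eq_measure)
qed

text \<open>Supplies the integral over the weight of the lightest vertex. Excluding
  \<open>e = \<beta> - 1\<close> rules out a logarithmic antiderivative.\<close>

lemma nn_integral_weight_measure_powr:
  assumes "0 < w0" "1 < \<beta>" "w0 \<le> w1" and e: "e \<noteq> \<beta> - 1" and c: "0 \<le> c"
  shows "(\<integral>\<^sup>+w. ennreal (c * w powr e) * indicator {w0..w1} w \<partial>weight_measure \<beta> w0)
     = ennreal (c * (\<beta> - 1) * w0 powr (\<beta> - 1) / (e - \<beta> + 1) * (w1 powr (e - \<beta> + 1) - w0 powr (e - \<beta> + 1)))"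
proof -
  let ?k = "c * (\<beta> - 1) * w0 powr (\<beta> - 1)"
  let ?F = "\<lambda>x. ?k / (e - \<beta> + 1) * x powr (e - \<beta> + 1)"
  have "(\<integral>\<^sup>+w. ennreal (c * w powr e) * indicator {w0..w1} w \<partial>weight_measure \<beta> w0)
      = (\<integral>\<^sup>+w. ennreal (?k * w powr (e - \<beta>)) * indicator {w0..w1} w \<partial>lborel)"
    unfolding weight_measure_eq_density[OF assms(1,2)]
  proof (subst nn_integral_density)
    show "(\<integral>\<^sup>+w. ennreal (weight_density \<beta> w0 w) * indicator {w0..} w * (ennreal (c * w powr e) * indicator {w0..w1} w) \<partial>lborel)
      = (\<integral>\<^sup>+w. ennreal (?k * w powr (e - \<beta>)) * indicator {w0..w1} w \<partial>lborel)"
      using assms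
      by (intro nn_integral_cong)
         (auto simp: weight_density_def ennreal_mult''[symmetric] powr_diff powr_minus divide_inverse ac_simps split: split_indicator)
  qed auto
  also have "\<dots> = ennreal (?F w1 - ?F w0)"
  proof (rule nn_integral_FTC_Icc)
    fix x assume "x \<in> {w0..w1}"
    then have "0 < x" using assms by simp
    from DERIV_cmult[OF has_real_derivative_powr[OF this, of "e - \<beta> + 1"], of "?k / (e - \<beta> + 1)"]
    show "DERIV ?F x :> ?k * x powr (e - \<beta>)" using e by (simp add: mult.assoc)
  qed (use assms in auto)
  also have "?F w1 - ?F w0 = ?k / (e - \<beta> + 1) * (w1 powr (e - \<beta> + 1) - w0 powr (e - \<beta> + 1))"
    by (simp add: right_diff_distrib)
  finally show ?thesis .
qed

subsection \<open>Cliques around a vertex of minimal weight\<close>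


text \<open>In the event that a vertex \<open>u\<close> of minimal weight sees every other vertex \<open>v\<close> at no more
  than half the threshold of two vertices of weight \<open>fst u\<close>, the triangle inequality makes all
  pairs adjacent. The condition is phrased through \<open>ball_vol\<close> to keep it measurable.\<close>

definition half_close :: "real \<Rightarrow> nat \<Rightarrow> ereal \<Rightarrow> real \<times> (real ^ 'd) \<Rightarrow> real \<times> (real ^ 'd) \<Rightarrow> bool" where
  "half_close \<Lambda> n p u v \<longleftrightarrow> fst u < fst v \<and>
     ball_vol TYPE('d) p (2 * periodic_dist p (snd u) (snd v)) \<le> min 1 (\<Lambda> * fst u * fst u / real n)"

section \<open>The distribution of a single vertex\<close>

abbreviation vertex_measure :: "real \<Rightarrow> real \<Rightarrow> (real \<times> (real ^ 'd)) measure" where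
  "vertex_measure \<beta> w0 \<equiv> weight_measure \<beta> w0 \<Otimes>\<^sub>M torus_measure"

lemma prob_space_vertex_measure:
  assumes "0 < w0" "1 < \<beta>"
  shows "prob_space (vertex_measure \<beta> w0 :: (real \<times> (real ^ 'd)) measure)"
proof -
  interpret W: real_distribution "weight_measure \<beta> w0"
    by (rule real_distribution_weight_measure[OF assms])
  interpret T: prob_space "torus_measure :: (real ^ 'd) measure" by (rule prob_space_torus_measure)
  interpret pair_prob_space "weight_measure \<beta> w0" "torus_measure :: (real ^ 'd) measure" ..
  show ?thesis by (rule prob_space_axioms)
qed

lemma sets_weight_measure [measurable_cong, simp]: "sets (weight_measure \<beta> w0) = sets borel"
  by (simp add: weight_measure_def)

lemma space_weight_measure [simp]: "space (weight_measure \<beta> w0) = UNIV"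
  by (simp add: weight_measure_def)

lemma measurable_vertex_components:
  assumes "f \<in> M \<rightarrow>\<^sub>M (vertex_measure \<beta> w0 :: (real \<times> (real ^ 'd)) measure)"
  shows "(\<lambda>x. fst (f x)) \<in> borel_measurable M" "(\<lambda>x. snd (f x)) \<in> borel_measurable M"
proof -
  have "fst \<in> borel_measurable (vertex_measure \<beta> w0 :: (real \<times> (real ^ 'd)) measure)"
    "snd \<in> borel_measurable (vertex_measure \<beta> w0 :: (real \<times> (real ^ 'd)) measure)"
    by measurable
  from this[THEN measurable_compose[OF assms]]
  show "(\<lambda>x. fst (f x)) \<in> borel_measurable M" "(\<lambda>x. snd (f x)) \<in> borel_measurable M" .
qed

lemma pred_half_close [measurable]:
  assumes "f \<in> M \<rightarrow>\<^sub>M vertex_measure \<beta> w0" "g \<in> M \<rightarrow>\<^sub>M vertex_measure \<beta> w0"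
  shows "Measurable.pred M (\<lambda>x. half_close \<Lambda> n p (f x) (g x))"
proof -
  note measurable_vertex_components[OF assms(1), measurable] measurable_vertex_components[OF assms(2), measurable]
  show ?thesis unfolding half_close_def by measurable
qed

text \<open>Weight and position are independent: the weight tail above \<open>w\<close> gives the
  power \<open>w powr (1 - \<beta>)\<close>, and the ball of half the radius \<open>t w w\<close>
  keeps at least the fraction \<open>1 / 2 ^ d\<close> of the volume
  \<open>\<Lambda> * w * w / n\<close>.\<close>

lemma emeasure_half_close_ge:
  fixes x :: "real ^ 'd"
  assumes t: "girg_threshold TYPE('d) n \<Lambda> w0 p t"
    and p: "1 \<le> p" and pos: "0 < \<Lambda>" "0 < w0" "1 < \<beta>" "0 < n"
    and w: "w0 \<le> w" "\<Lambda> * w * w / real n \<le> 1"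
  shows "ennreal (w0 powr (\<beta> - 1) * w powr (1 - \<beta>) * (\<Lambda> * w * w / real n / 2 ^ CARD('d)))
     \<le> emeasure (vertex_measure \<beta> w0) {z \<in> space (vertex_measure \<beta> w0). half_close \<Lambda> n p (w, x) z}"
proof -
  let ?T = "torus_measure :: (real ^ 'd) measure"
  interpret T: prob_space ?T by (rule prob_space_torus_measure)
  let ?B = "{y \<in> space ?T. ball_vol TYPE('d) p (2 * periodic_dist p x y) \<le> min 1 (\<Lambda> * w * w / real n)}"
  have eq: "ball_vol TYPE('d) p (t w w) = \<Lambda> * w * w / real n"
    using ball_vol_threshold[OF t w(1) w(1)] w(2) by simp
  have [measurable]: "?B \<in> sets ?T" by measurable
  have "{z \<in> space (vertex_measure \<beta> w0). half_close \<Lambda> n p (w, x) z} = {w<..} \<times> ?B"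
    by (auto simp: half_close_def space_pair_measure)
  then have "emeasure (vertex_measure \<beta> w0) {z \<in> space (vertex_measure \<beta> w0). half_close \<Lambda> n p (w, x) z}
      = ennreal (w0 powr (\<beta> - 1) * w powr (1 - \<beta>)) * emeasure ?T ?B"
    using pos w by (simp add: T.emeasure_pair_measure_Times emeasure_weight_measure_greaterThan)
  also have "\<dots> \<ge> ennreal (w0 powr (\<beta> - 1) * w powr (1 - \<beta>)) * ennreal (\<Lambda> * w * w / real n / 2 ^ CARD('d))"
  proof (intro mult_left_mono)
    have "ennreal (\<Lambda> * w * w / real n / 2 ^ CARD('d)) \<le> ennreal (ball_vol TYPE('d) p (t w w / 2))"
      using ball_vol_half[where 'd='d, OF p, of "t w w"] unfolding eq by (rule ennreal_leI)
    also have "\<dots> = emeasure ?T {y \<in> torus. periodic_dist p x y \<le> t w w / 2}"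
      by (rule emeasure_torus_ball[symmetric])
    also have "\<dots> \<le> emeasure ?T ?B"
    proof (rule emeasure_mono)
      show "{y \<in> torus. periodic_dist p x y \<le> t w w / 2} \<subseteq> ?B"
      proof
        fix y assume y: "y \<in> {y \<in> torus. periodic_dist p x y \<le> t w w / 2}"
        then have "ball_vol TYPE('d) p (2 * periodic_dist p x y) \<le> ball_vol TYPE('d) p (t w w)"
          by (intro ball_vol_mono) simp
        then show "y \<in> ?B" using y w(2) by (simp add: eq space_torus_measure)
      qed
    qed simp
    finally show "ennreal (\<Lambda> * w * w / real n / 2 ^ CARD('d)) \<le> emeasure ?T ?B" .
  qed simp
  finally show ?thesis by (subst ennreal_mult') simp
qed

text \<open>Take \<open>u\<close> as the lightest vertex of \<open>U\<close>. Given its weight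
  \<open>w\<close>, the other members are independent and each is half-close with probability at
  least a constant times \<open>w powr (3 - \<beta>)\<close>; the product of these bounds is
  integrated over \<open>w\<close> in \<open>{w0..w1}\<close>.\<close>

lemma emeasure_star_ge:
  assumes t: "girg_threshold TYPE('d::finite) n \<Lambda> w0 p t"
    and p: "1 \<le> p" and pos: "0 < \<Lambda>" "0 < w0" "1 < \<beta>" "0 < n"
    and w1: "w0 \<le> w1" "\<Lambda> * w1 * w1 / real n \<le> 1"
    and U: "U \<subseteq> {..<n}" "u \<in> U"
    and e: "e = (3 - \<beta>) * real (card U) - 2" "e \<noteq> 0"
  shows "ennreal ((w0 powr (\<beta> - 1) * (\<Lambda> / real n / 2 ^ CARD('d))) ^ (card U - 1)
           * (\<beta> - 1) * w0 powr (\<beta> - 1) / e * (w1 powr e - w0 powr e))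
     \<le> emeasure (girg_measure n \<beta> w0)
          {G \<in> space (girg_measure n \<beta> w0 :: (nat \<Rightarrow> real \<times> (real ^ 'd)) measure).
            fst (G u) \<in> {w0..w1} \<and> (\<forall>v\<in>U - {u}. half_close \<Lambda> n p (G u) (G v))}"
proof -
  let ?W = "weight_measure \<beta> w0"
  let ?T = "torus_measure :: (real ^ 'd) measure"
  let ?V = "vertex_measure \<beta> w0 :: (real \<times> (real ^ 'd)) measure"
  define I where "I = {..<n} - {u}"
  define m where "m = card U - 1"
  \<comment> \<open>The factor independent of \<open>w\<close> in
    \<open>emeasure_half_close_ge\<close>; what remains is
    \<open>w powr (1 - \<beta>) * w * w = w powr (3 - \<beta>)\<close>.\<close>
  define c where "c = w0 powr (\<beta> - 1) * (\<Lambda> / real n / 2 ^ CARD('d))"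
  interpret V: prob_space ?V by (rule prob_space_vertex_measure[OF pos(2,3)])
  interpret T: prob_space ?T by (rule prob_space_torus_measure)
  interpret product_prob_space "\<lambda>_. ?V" I ..
  have I: "finite I" "u \<notin> I" "insert u I = {..<n}" using U by (auto simp: I_def)
  have finU: "finite U" using U finite_subset by blast
  then have "0 < card U" using U(2) by (auto simp: card_gt_0_iff)
  then have cardU: "card (U - {u}) = m" "real (card U) = real m + 1"
    using U(2) finU by (auto simp: m_def)
  have c0: "0 \<le> c" using pos by (simp add: c_def)
  let ?A = "{G \<in> space (Pi\<^sub>M {..<n} (\<lambda>_. ?V)). fst (G u) \<in> {w0..w1} \<and> (\<forall>v\<in>U - {u}. half_close \<Lambda> n p (G u) (G v))}"
  have comp [measurable]: "(\<lambda>G. G v) \<in> Pi\<^sub>M {..<n} (\<lambda>_. ?V) \<rightarrow>\<^sub>M ?V" if "v \<in> U" for v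
    using that U by (intro measurable_component_singleton) auto
  note measurable_vertex_components(1)[OF comp[OF U(2)], measurable]
  have A [measurable]: "?A \<in> sets (Pi\<^sub>M {..<n} (\<lambda>_. ?V))"
    using finU U(2) by measurable
  \<comment> \<open>The \<open>m\<close> other vertices contribute \<open>(3 - \<beta>) * m\<close>
    to the exponent, and integrating against the density adds \<open>1 - \<beta>\<close>.\<close>
  have ee: "(3 - \<beta>) * real m - \<beta> + 1 = e"
    unfolding e(1) cardU(2) by (simp add: algebra_simps)
  have "ennreal (c ^ m * (\<beta> - 1) * w0 powr (\<beta> - 1) / e * (w1 powr e - w0 powr e))
      = (\<integral>\<^sup>+w. ennreal (c ^ m * w powr ((3 - \<beta>) * real m)) * indicator {w0..w1} w \<partial>?W)"
    using nn_integral_weight_measure_powr[OF pos(2,3) w1(1), of "(3 - \<beta>) * real m" "c ^ m"] ee e(2) c0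
    by simp
  also have "\<dots> = (\<integral>\<^sup>+w. \<integral>\<^sup>+x. ennreal (c ^ m * w powr ((3 - \<beta>) * real m)) * indicator {w0..w1} w \<partial>?T \<partial>?W)"
    by (simp add: T.emeasure_space_1)
  also have "\<dots> = (\<integral>\<^sup>+z. ennreal (c ^ m * fst z powr ((3 - \<beta>) * real m)) * indicator {w0..w1} (fst z) \<partial>?V)"
    by (subst T.nn_integral_fst[symmetric]) auto
  also have "\<dots> \<le> (\<integral>\<^sup>+z. \<integral>\<^sup>+G. indicator ?A (G(u := z)) \<partial>Pi\<^sub>M I (\<lambda>_. ?V) \<partial>?V)"
  proof (rule nn_integral_mono)
    fix z assume z: "z \<in> space ?V"
    show "ennreal (c ^ m * fst z powr ((3 - \<beta>) * real m)) * indicator {w0..w1} (fst z)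
        \<le> (\<integral>\<^sup>+G. indicator ?A (G(u := z)) \<partial>Pi\<^sub>M I (\<lambda>_. ?V))"
    proof (cases "fst z \<in> {w0..w1}")
      case True
      obtain w x where wx: "z = (w, x)" by (cases z)
      have w: "w0 \<le> w" "w \<le> w1" using True by (auto simp: wx)
      then have "\<Lambda> * w * w / real n \<le> \<Lambda> * w1 * w1 / real n"
        using pos by (intro divide_right_mono mult_mono) auto
      then have wn: "\<Lambda> * w * w / real n \<le> 1" using w1 by simp
      let ?S = "{y \<in> space ?V. half_close \<Lambda> n p z y}"
      let ?C = "{G \<in> space (Pi\<^sub>M I (\<lambda>_. ?V)). \<forall>v\<in>U - {u}. G v \<in> ?S}"
      have S: "?S \<in> sets ?V" using z by measurable
      have sub: "U - {u} \<subseteq> I" using U by (auto simp: I_def)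
      have "w powr (1 - \<beta>) * w * w = w powr (3 - \<beta>)"
        using w pos by (simp add: powr_diff power2_eq_square powr_numeral power3_eq_cube field_simps)
      then have "w0 powr (\<beta> - 1) * w powr (1 - \<beta>) * (\<Lambda> * w * w / real n / 2 ^ CARD('d)) = c * w powr (3 - \<beta>)"
        unfolding c_def by (simp add: ac_simps)
      then have ge: "ennreal (c * w powr (3 - \<beta>)) \<le> emeasure ?V ?S"
        using emeasure_half_close_ge[OF t p pos w(1) wn, of x] by (simp add: wx)
      have "c ^ m * w powr ((3 - \<beta>) * real m) = (c * w powr (3 - \<beta>)) ^ m"
        using w pos by (simp add: power_mult_distrib powr_powr[symmetric] powr_realpow)
      then have "ennreal (c ^ m * fst z powr ((3 - \<beta>) * real m)) = ennreal (c * w powr (3 - \<beta>)) ^ m"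
        using c0 by (simp add: wx ennreal_power)
      also have "\<dots> \<le> emeasure ?V ?S ^ m" by (intro power_mono ge) simp
      also have "\<dots> = emeasure (Pi\<^sub>M I (\<lambda>_. ?V)) ?C"
        using finU by (subst emeasure_PiM_Collect[OF sub _ S]) (auto simp: cardU)
      also have "\<dots> = (\<integral>\<^sup>+G. indicator ?C G \<partial>Pi\<^sub>M I (\<lambda>_. ?V))"
      proof (rule nn_integral_indicator[symmetric], rule sets.sets_Collect_finite_All)
        fix v assume "v \<in> U - {u}"
        then show "{G \<in> space (Pi\<^sub>M I (\<lambda>_. ?V)). G v \<in> ?S} \<in> sets (Pi\<^sub>M I (\<lambda>_. ?V))"
          using sub S by (intro sets_Collect_single') auto
      qed (use finU in simp)
      also have "\<dots> \<le> (\<integral>\<^sup>+G. indicator ?A (G(u := z)) \<partial>Pi\<^sub>M I (\<lambda>_. ?V))"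
      proof (rule nn_integral_mono)
        fix G assume G: "G \<in> space (Pi\<^sub>M I (\<lambda>_. ?V))"
        have "G(u := z) \<in> space (Pi\<^sub>M {..<n} (\<lambda>_. ?V))"
          using G z unfolding I(3)[symmetric] space_PiM by (auto simp: PiE_iff extensional_def)
        then show "indicator ?C G \<le> (indicator ?A (G(u := z)) :: ennreal)"
          using True by (auto split: split_indicator)
      qed
      finally show ?thesis using True by simp
    qed simp
  qed
  also have "\<dots> = (\<integral>\<^sup>+G. indicator ?A G \<partial>Pi\<^sub>M (insert u I) (\<lambda>_. ?V))"
    using A unfolding I(3)[symmetric] by (intro product_nn_integral_insert_rev[OF I(1,2), symmetric]) auto
  also have "\<dots> = emeasure (Pi\<^sub>M {..<n} (\<lambda>_. ?V)) ?A"
    unfolding I(3) by (rule nn_integral_indicator[OF A])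
  finally show ?thesis unfolding girg_measure_def c_def m_def .
qed


text \<open>Heavier endpoints only enlarge the admissible volume, so a bound at a common lower
  weight \<open>w\<close> suffices. The free radius \<open>r\<close> makes room for the maximum in
  the star argument.\<close>

lemma girg_adj_of_light_vertex:
  fixes u v :: "real \<times> (real ^ 'd)"
  assumes t: "girg_threshold TYPE('d) n \<Lambda> w0 p t"
    and p: "1 \<le> p" and pos: "0 < \<Lambda>" "0 < w0" "0 < n"
    and w: "w0 \<le> w" "w \<le> fst u" "w \<le> fst v" and torus: "snd u \<in> torus" "snd v \<in> torus"
    and r: "periodic_dist p (snd u) (snd v) \<le> r" "ball_vol TYPE('d) p r \<le> min 1 (\<Lambda> * w * w / real n)"
  shows "girg_adj p t u v"
proof -
  have "ball_vol TYPE('d) p (periodic_dist p (snd u) (snd v)) \<le> min 1 (\<Lambda> * w * w / real n)"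
    using ball_vol_mono[where 'd='d, OF r(1), of p] r(2) by linarith
  also have "\<Lambda> * w * w / real n \<le> \<Lambda> * fst u * fst v / real n"
    using w pos by (intro divide_right_mono mult_mono) auto
  then have "min 1 (\<Lambda> * w * w / real n) \<le> min 1 (\<Lambda> * fst u * fst v / real n)" by simp
  finally have "girg_adj p t (fst u, snd u) (fst v, snd v)"
    using w by (subst girg_adj_iff_ball_vol[OF t p pos _ _ torus]) auto
  then show ?thesis by simp
qed

text \<open>The distance of two leaves is at most the sum of their distances to \<open>u\<close>,
  hence at most twice the larger one, and \<open>half_close\<close> bounds the volume of the ball
  with that doubled radius.\<close>

lemma girg_clique_of_star:
  fixes G :: "nat \<Rightarrow> real \<times> (real ^ 'd)"
  assumes t: "girg_threshold TYPE('d) n \<Lambda> w0 p t"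
    and p: "1 \<le> p" and pos: "0 < \<Lambda>" "0 < w0" "0 < n"
    and torus: "\<And>v. v \<in> U \<Longrightarrow> snd (G v) \<in> torus"
    and u: "u \<in> U" "w0 \<le> fst (G u)"
    and star: "\<And>v. v \<in> U - {u} \<Longrightarrow> half_close \<Lambda> n p (G u) (G v)"
  shows "girg_clique p t G U"
  unfolding girg_clique_def
proof (intro ballI impI)
  fix a b assume ab: "a \<in> U" "b \<in> U" "a \<noteq> b"
  let ?d = "\<lambda>v. periodic_dist p (snd (G u)) (snd (G v))"
  \<comment> \<open>The centre gets radius 0, so the maximum is always attained at a leaf.\<close>
  let ?r = "\<lambda>v. if v = u then 0 else 2 * ?d v"
  have dist: "periodic_dist p (snd (G a)) (snd (G b)) \<le> max (?r a) (?r b)"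
  proof -
    have "periodic_dist p (snd (G a)) (snd (G b)) \<le> ?d a + ?d b"
      using periodic_dist_triangle[OF p, of "snd (G a)" "snd (G b)" "snd (G u)"]
      by (simp add: periodic_dist_commute)
    moreover have "periodic_dist p (snd (G a)) (snd (G b)) = ?d a" if "b = u"
      using that by (simp add: periodic_dist_commute)
    ultimately show ?thesis
      using ab(3) periodic_dist_nonneg[of p "snd (G u)" "snd (G a)"]
        periodic_dist_nonneg[of p "snd (G u)" "snd (G b)"] by auto
  qed
  show "girg_adj p t (G a) (G b)"
  proof (rule girg_adj_of_light_vertex[OF t p pos u(2) _ _ torus[OF ab(1)] torus[OF ab(2)] dist])
    have le: "fst (G u) \<le> fst (G v)" if "v \<in> U" for v
      using star[of v] that by (cases "v = u") (auto simp: half_close_def)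
    show "fst (G u) \<le> fst (G a)" "fst (G u) \<le> fst (G b)" using le ab by auto
    have d: "0 \<le> ?d v" for v by (rule periodic_dist_nonneg)
    obtain v where v: "v \<in> U - {u}" "max (?r a) (?r b) = 2 * ?d v"
    \<comment> \<open>The test \<open>a \<noteq> u\<close> settles a tie at 0 in favour of the
      leaf.\<close>
    proof (cases "?r b \<le> ?r a \<and> a \<noteq> u")
      case True
      then have "max (?r a) (?r b) = ?r a" by (intro max_absorb1) blast
      then show thesis using True ab(1) by (intro that[of a]) simp_all
    next
      case False
      have "b \<noteq> u"
      proof
        assume "b = u"
        with False ab(3) d[of a] show False by simp
      qed
      have "?r a \<le> ?r b"
        using False \<open>b \<noteq> u\<close> d[of b] by (cases "a = u") auto
      then have "max (?r a) (?r b) = ?r b" by (rule max_absorb2)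
      then show thesis using \<open>b \<noteq> u\<close> ab(2) by (intro that[of b]) simp_all
    qed
    from star[OF v(1)] show "ball_vol TYPE('d) p (max (?r a) (?r b)) \<le> min 1 (\<Lambda> * fst (G u) * fst (G u) / real n)"
      unfolding v(2) half_close_def by simp
  qed
qed

section \<open>Measurability and probability of the clique event\<close>

lemma pred_ball_vol_le:
  fixes f g :: "'a \<Rightarrow> real \<times> (real ^ 'd)"
  assumes "f \<in> M \<rightarrow>\<^sub>M vertex_measure \<beta> w0" "g \<in> M \<rightarrow>\<^sub>M vertex_measure \<beta> w0"
  shows "Measurable.pred M (\<lambda>x. ball_vol TYPE('d) p (periodic_dist p (snd (f x)) (snd (g x)))
    \<le> min 1 (\<Lambda> * fst (f x) * fst (g x) / real n))"
proof -
  note measurable_vertex_components[OF assms(1), measurable] measurable_vertex_components[OF assms(2), measurable]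
  show ?thesis by measurable
qed

text \<open>For each \<open>u\<close> in \<open>U\<close> the event contains the star event with
  centre \<open>u\<close>. These are disjoint and obey the same lower bound, which gives the factor
  \<open>card U\<close>.\<close>

lemma
  fixes w1 :: real
  assumes t: "girg_threshold TYPE('d::finite) n \<Lambda> w0 p t"
    and p: "1 \<le> p" and pos: "0 < \<Lambda>" "0 < w0" "1 < \<beta>" "0 < n"
    and U: "U \<subseteq> {..<n}" "U \<noteq> {}"
  defines "E \<equiv> {G \<in> space (girg_measure n \<beta> w0 :: (nat \<Rightarrow> real \<times> (real ^ 'd)) measure).
      girg_clique p t G U \<and> w0 \<le> Min ((\<lambda>v. fst (G v)) ` U) \<and> Min ((\<lambda>v. fst (G v)) ` U) \<le> w1}"
  shows clique_event_sets: "E \<in> sets (girg_measure n \<beta> w0)"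
    and emeasure_clique_event_ge:
      "w0 \<le> w1 \<Longrightarrow> \<Lambda> * w1 * w1 / real n \<le> 1 \<Longrightarrow>
       e = (3 - \<beta>) * real (card U) - 2 \<Longrightarrow> e \<noteq> 0 \<Longrightarrow>
       ennreal (real (card U) * ((w0 powr (\<beta> - 1) * (\<Lambda> / real n / 2 ^ CARD('d))) ^ (card U - 1)
           * (\<beta> - 1) * w0 powr (\<beta> - 1) / e * (w1 powr e - w0 powr e)))
       \<le> emeasure (girg_measure n \<beta> w0) E"
proof -
  let ?V = "vertex_measure \<beta> w0 :: (real \<times> (real ^ 'd)) measure"
  let ?M = "girg_measure n \<beta> w0 :: (nat \<Rightarrow> real \<times> (real ^ 'd)) measure"
  have finU: "finite U" using U finite_subset by blast
  have torus: "snd (G v) \<in> torus" if "G \<in> space ?M" "v \<in> U" for G v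
  proof -
    have "G v \<in> space ?V" using that U by (auto simp: girg_measure_def space_PiM)
    then show ?thesis by (auto simp: space_pair_measure space_torus_measure)
  qed
  have Min_iff: "w0 \<le> Min ((\<lambda>v. fst (G v)) ` U) \<longleftrightarrow> (\<forall>v\<in>U. w0 \<le> fst (G v))"
    "Min ((\<lambda>v. fst (G v)) ` U) \<le> w1 \<longleftrightarrow> (\<exists>v\<in>U. fst (G v) \<le> w1)" for G :: "nat \<Rightarrow> real \<times> (real ^ 'd)"
    using finU U(2) by (auto simp: Min_le_iff)
  have comp [measurable]: "(\<lambda>G. G v) \<in> ?M \<rightarrow>\<^sub>M ?V" if "v \<in> U" for v
    unfolding girg_measure_def using that U by (intro measurable_component_singleton) auto
  note coord = measurable_vertex_components[OF comp]
  define adj where "adj G u v \<longleftrightarrow> ball_vol TYPE('d) p (periodic_dist p (snd (G u)) (snd (G v)))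
      \<le> min 1 (\<Lambda> * fst (G u) * fst (G v) / real n)" for G :: "nat \<Rightarrow> real \<times> (real ^ 'd)" and u v
  have [measurable]: "Measurable.pred ?M (\<lambda>G. adj G u v)" if "u \<in> U" "v \<in> U" for u v
    unfolding adj_def by (rule pred_ball_vol_le[OF comp comp]) (rule that)+
  \<comment> \<open>The threshold condition speaks of weights at least \<open>w0\<close>, which the
    event itself guarantees through the minimum; this yields a form of \<open>E\<close> free of
    \<open>t\<close>.\<close>
  have "girg_adj p t (G u) (G v) \<longleftrightarrow> adj G u v"
    if "G \<in> space ?M" "\<forall>v\<in>U. w0 \<le> fst (G v)" "u \<in> U" "v \<in> U" for G u v
    using girg_adj_iff_ball_vol[OF t p pos(1,2,4) _ _ torus[OF that(1,3)] torus[OF that(1,4)],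
        of "fst (G u)" "fst (G v)"] that by (simp add: adj_def)
  then have "E = {G \<in> space ?M. (\<forall>u\<in>U. \<forall>v\<in>U. u \<noteq> v \<longrightarrow> adj G u v)
      \<and> (\<forall>v\<in>U. w0 \<le> fst (G v)) \<and> (\<exists>v\<in>U. fst (G v) \<le> w1)}" (is "_ = ?E'")
    unfolding E_def Min_iff girg_clique_def by auto
  also have "?E' \<in> sets ?M" using finU coord(1)[measurable] by measurable
  finally show E: "E \<in> sets ?M" .
  assume w1: "w0 \<le> w1" "\<Lambda> * w1 * w1 / real n \<le> 1" and e: "e = (3 - \<beta>) * real (card U) - 2" "e \<noteq> 0"
  define A where "A u = {G \<in> space ?M. fst (G u) \<in> {w0..w1} \<and> (\<forall>v\<in>U - {u}. half_close \<Lambda> n p (G u) (G v))}" for u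
  have A: "A u \<in> sets ?M" if "u \<in> U" for u
    unfolding A_def using finU that coord(1)[OF that, measurable] by measurable
  \<comment> \<open>The strict inequality in \<open>half_close\<close> makes the centre the unique
    lightest vertex.\<close>
  have disj: "disjoint_family_on A U"
  proof -
    have False if "G \<in> A u" "G \<in> A v" "u \<in> U" "v \<in> U" "u \<noteq> v" for G u v
    proof -
      have "fst (G u) < fst (G v)" "fst (G v) < fst (G u)"
        using that by (auto simp: A_def half_close_def)
      then show False by simp
    qed
    then show ?thesis unfolding disjoint_family_on_def by blast
  qed
  have AE: "A u \<subseteq> E" if "u \<in> U" for u
  proof
    fix G assume G: "G \<in> A u"
    then have M: "G \<in> space ?M" and Gu: "w0 \<le> fst (G u)" "fst (G u) \<le> w1"
      and star: "\<And>v. v \<in> U - {u} \<Longrightarrow> half_close \<Lambda> n p (G u) (G v)" by (auto simp: A_def)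
    have "girg_clique p t G U"
      by (rule girg_clique_of_star[where G=G and U=U, OF t p pos(1,2,4) _ that Gu(1)])
         (use torus[OF M] star in auto)
    moreover have "w0 \<le> fst (G v)" if "v \<in> U" for v
      using star[of v] that Gu(1) by (cases "v = u") (auto simp: half_close_def)
    ultimately show "G \<in> E" unfolding E_def Min_iff using M Gu(2) that by auto
  qed
  let ?c = "(w0 powr (\<beta> - 1) * (\<Lambda> / real n / 2 ^ CARD('d))) ^ (card U - 1)
           * (\<beta> - 1) * w0 powr (\<beta> - 1) / e * (w1 powr e - w0 powr e)"
  have "ennreal (real (card U) * ?c) = (\<Sum>u\<in>U. ennreal ?c)"
    by (subst ennreal_mult') (simp_all add: ennreal_of_nat_eq_real_of_nat)
  also have "\<dots> \<le> (\<Sum>u\<in>U. emeasure ?M (A u))"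
    unfolding A_def by (intro sum_mono emeasure_star_ge[OF t p pos w1 U(1) _ e])
  also have "\<dots> = emeasure ?M (\<Union>u\<in>U. A u)"
    using A finU disj by (intro sum_emeasure) auto
  also have "\<dots> \<le> emeasure ?M E" using AE E by (intro emeasure_mono) auto
  finally show "ennreal (real (card U) * ?c) \<le> emeasure ?M E" .
qed

section \<open>Averaging over the random vertex set\<close>

theorem lemma9:
  fixes \<Lambda> w0 \<beta> w_plus :: real and n k :: nat and p :: ereal
    and t :: "real \<Rightarrow> real \<Rightarrow> real"
  assumes "\<Lambda> > 0" and "w0 > 0" and "\<beta> > 2"
    and "1 \<le> p"
    and "1 \<le> k" and "k \<le> n"
    and "girg_threshold TYPE('d::finite) n \<Lambda> w0 p t"
    and "w0 \<le> w_plus" and "w_plus \<le> sqrt (real n / \<Lambda>)"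
  shows "\<P>(\<omega> in (girg_measure n \<beta> w0 :: (nat \<Rightarrow> real \<times> (real ^ 'd)) measure) \<Otimes>\<^sub>M subset_measure n k.
            girg_clique p t (fst \<omega>) (snd \<omega>) \<and>
            w0 \<le> Min ((\<lambda>v. fst (fst \<omega> v)) ` snd \<omega>) \<and>
            Min ((\<lambda>v. fst (fst \<omega> v)) ` snd \<omega>) \<le> w_plus)
         \<ge> 2 powr (- (real CARD('d) * (real k - 1)))
            * ((\<beta> - 1) * real k * w0 powr (- (1 - \<beta>) * real k) / ((3 - \<beta>) * real k - 2))
            * (\<Lambda> / real n) ^ (k - 1)
            * (w_plus powr (real k * (3 - \<beta>) - 2) - w0 powr (real k * (3 - \<beta>) - 2))"
proof (cases "(3 - \<beta>) * real k - 2 = 0")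
  case True
  \<comment> \<open>The constant then contains a division by zero and the bound degenerates to \<open>0\<close>.\<close>
  then show ?thesis by simp
next
  case False
  let ?M = "girg_measure n \<beta> w0 :: (nat \<Rightarrow> real \<times> (real ^ 'd)) measure"
  let ?S = "subset_measure n k"
  define e where "e = (3 - \<beta>) * real k - 2"
  define SS where "SS = {U. U \<subseteq> {..<n} \<and> card U = k}"
  define E where "E U = {G \<in> space ?M. girg_clique p t G U \<and>
      w0 \<le> Min ((\<lambda>v. fst (G v)) ` U) \<and> Min ((\<lambda>v. fst (G v)) ` U) \<le> w_plus}" for U
  define R where "R = real k * ((w0 powr (\<beta> - 1) * (\<Lambda> / real n / 2 ^ CARD('d))) ^ (k - 1)
           * (\<beta> - 1) * w0 powr (\<beta> - 1) / e * (w_plus powr e - w0 powr e))"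
  let ?A = "{\<omega> \<in> space (?M \<Otimes>\<^sub>M ?S). girg_clique p t (fst \<omega>) (snd \<omega>) \<and>
            w0 \<le> Min ((\<lambda>v. fst (fst \<omega> v)) ` snd \<omega>) \<and>
            Min ((\<lambda>v. fst (fst \<omega> v)) ` snd \<omega>) \<le> w_plus}"
  have n: "0 < n" and \<beta>: "1 < \<beta>" using assms by auto
  \<comment> \<open>The upper bound on \<open>w_plus\<close> ensures that the connection probability
    of two vertices of this weight is not cut off by the minimum with 1.\<close>
  have "w_plus\<^sup>2 \<le> (sqrt (real n / \<Lambda>))\<^sup>2" using assms by (intro power_mono) auto
  then have w1: "\<Lambda> * w_plus * w_plus / real n \<le> 1"
    using assms n by (simp add: power2_eq_square field_simps)
  have SS: "finite SS" "SS \<noteq> {}"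
  proof -
    show "finite SS" by (rule finite_subset[of _ "Pow {..<n}"]) (auto simp: SS_def)
    have "{..<k} \<in> SS" using assms by (auto simp: SS_def)
    then show "SS \<noteq> {}" by blast
  qed
  have S: "space ?S = SS" "sets ?S = Pow SS"
    by (simp_all add: subset_measure_def SS_def space_uniform_count_measure sets_uniform_count_measure)
  interpret S: prob_space ?S
    unfolding subset_measure_def SS_def[symmetric] by (rule prob_space_uniform_count_measure[OF SS])
  interpret M: prob_space ?M
    unfolding girg_measure_def
    by (intro prob_space_PiM prob_space_vertex_measure[OF assms(2) \<beta>])
  interpret P: pair_prob_space ?M ?S ..
  have U: "U \<subseteq> {..<n}" "U \<noteq> {}" "card U = k" if "U \<in> SS" for U
    using that assms(5) by (auto simp: SS_def)
  have E: "E U \<in> sets ?M" "ennreal R \<le> emeasure ?M (E U)" if "U \<in> SS" for U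
    using clique_event_sets[OF assms(7,4,1,2) \<beta> n U(1,2)[OF that], of w_plus]
      emeasure_clique_event_ge[OF assms(7,4,1,2) \<beta> n U(1,2)[OF that] assms(8) w1, of e] False
    unfolding E_def R_def e_def U(3)[OF that] by auto
  \<comment> \<open>The vertex set ranges over the finite discrete space \<open>SS\<close>, so the
    event is a finite union of rectangles.\<close>
  have "?A = (\<Union>U\<in>SS. E U \<times> {U})"
    by (auto simp: space_pair_measure S E_def)
  also have "\<dots> \<in> sets (?M \<Otimes>\<^sub>M ?S)"
    using SS E S by (intro sets.finite_UN pair_measureI) auto
  finally have A: "?A \<in> sets (?M \<Otimes>\<^sub>M ?S)" .
  \<comment> \<open>The bound \<open>R\<close> is the same for every \<open>U\<close> of size
    \<open>k\<close>, so averaging over \<open>U\<close> preserves it.\<close>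
  have "ennreal R = (\<integral>\<^sup>+U. ennreal R \<partial>?S)" by (simp add: S.emeasure_space_1)
  also have "\<dots> \<le> (\<integral>\<^sup>+U. emeasure ?M ((\<lambda>G. (G, U)) -` ?A) \<partial>?S)"
  proof (rule nn_integral_mono)
    fix U assume "U \<in> space ?S"
    then have "U \<in> SS" by (simp add: S)
    moreover from this have "(\<lambda>G. (G, U)) -` ?A = E U"
      by (auto simp: space_pair_measure S E_def)
    ultimately show "ennreal R \<le> emeasure ?M ((\<lambda>G. (G, U)) -` ?A)" using E by simp
  qed
  also have "\<dots> = emeasure (?M \<Otimes>\<^sub>M ?S) ?A"
    by (rule P.emeasure_pair_measure_alt2[OF A, symmetric])
  finally have "R \<le> measure (?M \<Otimes>\<^sub>M ?S) ?A"
    by (simp add: P.emeasure_eq_measure)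
  moreover have "R = 2 powr (- (real CARD('d) * (real k - 1)))
            * ((\<beta> - 1) * real k * w0 powr (- (1 - \<beta>) * real k) / ((3 - \<beta>) * real k - 2))
            * (\<Lambda> / real n) ^ (k - 1)
            * (w_plus powr (real k * (3 - \<beta>) - 2) - w0 powr (real k * (3 - \<beta>) - 2))"
  proof -
    define m where "m = k - 1"
    have k: "real k = real m + 1" "k - 1 = m" using assms(5) by (auto simp: m_def)
    have "2 powr (- (real CARD('d) * (real k - 1))) = (1 / 2 ^ CARD('d)) ^ m"
      by (simp add: k powr_minus powr_powr[symmetric] powr_realpow power_divide divide_inverse power_inverse)
    \<comment> \<open>The \<open>m\<close> leaves and the centre each contribute one factor
      \<open>w0 powr (\<beta> - 1)\<close>.\<close>
    moreover have "w0 powr (- (1 - \<beta>) * real k) = (w0 powr (\<beta> - 1)) ^ m * w0 powr (\<beta> - 1)"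
    proof -
      have "w0 powr (- (1 - \<beta>) * real k) = w0 powr ((\<beta> - 1) * real m + (\<beta> - 1))"
        by (simp add: k algebra_simps)
      also have "\<dots> = (w0 powr (\<beta> - 1)) powr real m * w0 powr (\<beta> - 1)"
        by (simp add: powr_add powr_powr)
      finally show ?thesis using assms(2) by (simp add: powr_realpow)
    qed
    moreover have "real k * (3 - \<beta>) - 2 = e" by (simp add: e_def mult.commute)
    ultimately show ?thesis
      unfolding R_def k(2) e_def[symmetric] by (simp only:) (simp add: power_mult_distrib power_divide ac_simps)
  qed
  ultimately show ?thesis by simp
qed

end
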